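(* Let $x\geq 3$ be an integer, let $a,b,c\geq 0$ be integers, set $v=a+b+c+1$, and let $L=\{1^a,x^b,(x+1)^c\}$ be an admissible list. Then there exists a Hamiltonian path $H$ of $K_v$ with $\ell(H)=L$ in each of the following cases: (1) $x$ is odd and $a\geq \min\{3x-3,\, b+2x-3\}$; (2) $x$ is odd, $a\geq 2x-2$ and $c\geq \frac{4}{3}b$; (3) $x$ is even and $a\geq \min\{3x-1,\, c+2x-1\}$; (4) $x$ is even, $a\geq 2x-1$ and $b\geq c$.
   Context: $K_v$ is the complete graph on vertex set $\{0,1,\ldots,v-1\}$. The length of an edge $[x,y]$ is $\ell(x,y)=\min(|x-y|,\,v-|x-y|)$, and for a subgraph $H$, $\ell(H)$ is the list (multiset) of lengths of its edges. The notation $\{1^{a_1},2^{a_2},\ldots,t^{a_t}\}$ denotes the list (multiset) containing $a_i$ copies of $i$. A list $L$ of $v-1$ positive integers not exceeding $\lfloor v/2\rfloor$ is called admissible if for every divisor $d$ of $v$, the number of elements of $L$ (counted with multiplicity) that are multiples of $d$ is at most $v-d$. *)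

theory Defs
  imports Complex_Main "HOL-Library.Multiset"
begin

definition complete_graph_edges :: "nat \<Rightarrow> nat set set" where
  "complete_graph_edges v = {{i, j} | i j. i < v \<and> j < v \<and> i \<noteq> j}"

text \<open>A path is represented by the list of its vertices in order of traversal; its edges join
  consecutive entries. For \<open>distinct\<close> lists no edge occurs twice.\<close>

definition path_edges :: "'a list \<Rightarrow> ('a \<times> 'a) list" where
  "path_edges p = zip p (tl p)"

definition hamiltonian_path :: "'a set \<Rightarrow> 'a set set \<Rightarrow> 'a list \<Rightarrow> bool" where
  "hamiltonian_path V E p \<longleftrightarrow>
     distinct p \<and> set p = V \<and> (\<forall>(i, j) \<in> set (path_edges p). {i, j} \<in> E)"

definition edge_length :: "nat \<Rightarrow> nat \<Rightarrow> nat \<Rightarrow> nat" where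
  "edge_length v i j = min (nat \<bar>int i - int j\<bar>) (v - nat \<bar>int i - int j\<bar>)"

definition path_lengths :: "nat \<Rightarrow> nat list \<Rightarrow> nat multiset" where
  "path_lengths v p = mset (map (\<lambda>(i, j). edge_length v i j) (path_edges p))"

definition admissible :: "nat \<Rightarrow> nat multiset \<Rightarrow> bool" where
  "admissible v L \<longleftrightarrow>
     size L + 1 = v \<and>
     (\<forall>l \<in># L. 0 < l \<and> l \<le> v div 2) \<and>
     (\<forall>d. d dvd v \<longrightarrow> size (filter_mset (\<lambda>l. d dvd l) L) \<le> v - d)"

end

theory Submission
  imports Defs
begin

text \<open>Every path constructed here is linear: the prescribed lengths are the plain differences of
  consecutive vertices, so of admissibility only the bound \<open>v div 2\<close> on the lengths matters.
  Write \<open>{0..<v}\<close> row by row in a grid of width \<open>w\<close>. Moving inside a column costs \<open>w\<close>, moving to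
  the neighbouring column costs \<open>1\<close>, and where the last, incomplete row ends, moving along the
  upper border costs \<open>w - 1\<close>. Snakes through the columns that start at \<open>0\<close> thus realize
  \<open>{1\<^bsup>w-1\<^esup>, w\<^bsup>c\<^esup>}\<close> for \<open>w = x\<close> and \<open>w = x + 1\<close>, or, depending on parities,
  \<open>{1\<^bsup>w-2\<^esup>, w-1, w\<^bsup>c\<^esup>}\<close> and \<open>{1\<^bsup>w-2\<^esup>, (w-1)\<^sup>2, w\<^bsup>c\<^esup>}\<close> for \<open>w = x + 1\<close>. Two paths that
  start at \<open>0\<close> can be glued at this vertex after reflecting one of them, and any number of
  unit edges can be inserted there. The parity of \<open>b mod x\<close> (for odd \<open>x\<close>) or of \<open>c mod (x + 1)\<close>
  (for even \<open>x\<close>) decides which two paths to glue.\<close>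

section \<open>Walks on integer sets and their multisets of differences\<close>

definition diffs :: "int list \<Rightarrow> nat multiset" where
  "diffs p = mset (map (\<lambda>(i, j). nat \<bar>i - j\<bar>) (path_edges p))"

lemma diffs_Nil [simp]: "diffs [] = {#}"
  and diffs_single [simp]: "diffs [i] = {#}"
  and diffs_Cons_Cons [simp]: "diffs (i # j # p) = add_mset (nat \<bar>i - j\<bar>) (diffs (j # p))"
  by (simp_all add: diffs_def path_edges_def)

lemma diffs_append:
  assumes "p \<noteq> []" "q \<noteq> []"
  shows "diffs (p @ q) = diffs p + diffs q + {#nat \<bar>last p - hd q\<bar>#}"
  using assms
proof (induction p rule: induct_list012)
  case (2 i)
  then show ?case by (cases q) auto
qed auto

lemma diffs_rev: "diffs (rev p) = diffs p"
proof (induction p rule: induct_list012)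
  case (3 i j p)
  then show ?case
    by (simp add: diffs_append[of "rev p @ [j]" "[i]", simplified] abs_minus_commute)
qed auto

lemma diffs_map:
  assumes "\<And>i j. \<bar>f i - f j\<bar> = \<bar>i - j\<bar>"
  shows "diffs (map f p) = diffs p"
  by (induction p rule: induct_list012) (simp_all add: assms)

lemma size_diffs: "size (diffs p) = length p - 1"
  by (simp add: diffs_def path_edges_def)

definition walk :: "int set \<Rightarrow> int \<Rightarrow> int \<Rightarrow> nat multiset \<Rightarrow> bool" where
  "walk A s e M \<longleftrightarrow>
     (\<exists>p. p \<noteq> [] \<and> distinct p \<and> set p = A \<and> hd p = s \<and> last p = e \<and> diffs p = M)"

lemma walk_single: "walk {i} i i {#}"
  unfolding walk_def by (intro exI[of _ "[i]"]) simp

lemma walk_card: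
  assumes "walk A s e M"
  shows "card A = size M + 1"
proof -
  obtain p where "p \<noteq> []" "distinct p" "set p = A" "diffs p = M"
    using assms unfolding walk_def by blast
  then show ?thesis
    using size_diffs[of p] distinct_card[of p] by auto
qed

lemma walk_rev: "walk A s e M \<Longrightarrow> walk A e s M"
  unfolding walk_def by (metis diffs_rev distinct_rev hd_rev last_rev rev_is_Nil_conv set_rev)

lemma walk_join:
  assumes "walk A s e M" "walk B s' e' N" "A \<inter> B = {}"
  shows "walk (A \<union> B) s e' (M + N + {#nat \<bar>e - s'\<bar>#})"
proof -
  obtain p q where
    "p \<noteq> []" "distinct p" "set p = A" "hd p = s" "last p = e" "diffs p = M"
    "q \<noteq> []" "distinct q" "set q = B" "hd q = s'" "last q = e'" "diffs q = N"
    using assms unfolding walk_def by blast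
  then show ?thesis
    using assms(3) unfolding walk_def by (intro exI[of _ "p @ q"]) (simp add: diffs_append)
qed

lemma walk_glue:
  assumes "walk A s e M" "walk B e f N" "A \<inter> B = {e}"
  shows "walk (A \<union> B) s f (M + N)"
proof -
  obtain p q where p: "p \<noteq> []" "distinct p" "set p = A" "hd p = s" "last p = e" "diffs p = M"
    and q: "q \<noteq> []" "distinct q" "set q = B" "hd q = e" "last q = f" "diffs q = N"
    using assms unfolding walk_def by blast
  \<comment> \<open>The shared vertex is dropped from the second list; since
    \<open>last p = e\<close>, the first difference of \<open>q\<close> reappears at the
    seam.\<close>
  obtain r where r: "q = e # r"
    using q by (cases q) auto
  show ?thesis
  proof (cases r)
    case Nil
    then show ?thesis
      using p q r assms unfolding walk_def by (intro exI[of _ p]) auto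
  next
    case (Cons j t)
    have "set p \<inter> set r = {}"
      using p q r assms(3) by auto
    moreover have "set p \<union> set r = A \<union> B"
      using p q r by (metis Un_insert_right insert_absorb last_in_set list.simps(15) UnI1)
    ultimately show ?thesis
      using p q r Cons unfolding walk_def
      by (intro exI[of _ "p @ r"]) (auto simp: diffs_append)
  qed
qed

text \<open>The hypothesis makes \<open>f\<close> an isometry, hence injective; it is applied to
  translations and reflections.\<close>

lemma walk_map:
  assumes "walk A s e M" "\<And>i j. \<bar>f i - f j\<bar> = \<bar>i - j\<bar>"
  shows "walk (f ` A) (f s) (f e) M"
proof -
  obtain p where p: "p \<noteq> []" "distinct p" "set p = A" "hd p = s" "last p = e" "diffs p = M"
    using assms(1) unfolding walk_def by blast
  have "inj f"
    using assms(2) by (metis abs_eq_0 injI right_minus_eq)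
  then show ?thesis
    using p unfolding walk_def
    by (intro exI[of _ "map f p"])
      (auto simp: diffs_map assms(2) hd_map last_map distinct_map inj_on_def)
qed

section \<open>Walks starting at the border vertex 0, and their gluing\<close>

definition standard :: "nat multiset \<Rightarrow> bool" where
  "standard L \<longleftrightarrow> (\<exists>e. walk {0..int (size L)} 0 e L)"

text \<open>Shift the walk by one and enter it from the freed vertex 0.\<close>

lemma standard_add_one:
  assumes "standard L"
  shows "standard (add_mset 1 L)"
proof -
  obtain e where e: "walk {0..int (size L)} 0 e L"
    using assms unfolding standard_def by blast
  have "walk ((\<lambda>i. i + 1) ` {0..int (size L)}) (0 + 1) (e + 1) L"
    using e by (rule walk_map) simp
  then have "walk ({0} \<union> (\<lambda>i. i + 1) ` {0..int (size L)}) 0 (e + 1) ({#} + L + {#nat \<bar>0 - 1\<bar>#})"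
    by (intro walk_join walk_single) auto
  moreover have "{0} \<union> (\<lambda>i. i + 1) ` {0..int (size L)} = {0..int (size (add_mset 1 L))}"
    by auto
  ultimately show ?thesis
    unfolding standard_def by auto
qed

lemma standard_add_ones: "standard L \<Longrightarrow> standard (replicate_mset k 1 + L)"
  by (induction k) (simp_all add: standard_add_one[simplified])

text \<open>The first walk is reflected in its interval and reversed, so that it ends at
  \<open>m\<close>; the second is translated to start there. The two intervals meet only in
  \<open>m\<close>.\<close>

lemma standard_glue:
  assumes "standard L" "standard M"
  obtains s e where "walk {0..int (size (L + M))} s e (L + M)"
proof -
  define m where "m = int (size L)"
  obtain d where d: "walk {0..m} 0 d L"
    using assms(1) unfolding standard_def m_def by blast
  obtain e where e: "walk {0..int (size M)} 0 e M"
    using assms(2) unfolding standard_def by blast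
  have "walk ((\<lambda>i. m - i) ` {0..m}) (m - 0) (m - d) L"
    using d by (rule walk_map) auto
  then have 1: "walk {0..m} (m - d) m L"
    by (simp add: walk_rev)
  have "walk ((\<lambda>i. m + i) ` {0..int (size M)}) (m + 0) (m + e) M"
    using e by (rule walk_map) auto
  then have 2: "walk {m..m + int (size M)} m (m + e) M"
    by (simp add: add.commute)
  have "walk ({0..m} \<union> {m..m + int (size M)}) (m - d) (m + e) (L + M)"
    by (rule walk_glue[OF 1 2]) (auto simp: m_def)
  moreover have "{0..m} \<union> {m..m + int (size M)} = {0..int (size (L + M))}"
    by (auto simp: m_def)
  ultimately show ?thesis
    using that by metis
qed

text \<open>A difference of at most \<open>v div 2\<close> does not exceed its complement, so the
  minimum in \<open>edge_length\<close> is the plain difference.\<close>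

lemma hamiltonian_path_of_walk:
  assumes "admissible v L" "walk {0..int (size L)} s e L"
  shows "\<exists>H. hamiltonian_path {0..<v} (complete_graph_edges v) H \<and> path_lengths v H = L"
proof -
  have v: "v = size L + 1" and L: "\<And>l. l \<in># L \<Longrightarrow> 0 < l \<and> l \<le> v div 2"
    using assms(1) unfolding admissible_def by auto
  obtain p where p: "p \<noteq> []" "distinct p" "set p = {0..int (size L)}" "diffs p = L"
    using assms(2) unfolding walk_def by blast
  define H where "H = map nat p"
  have nn: "0 \<le> i" if "i \<in> set p" for i
    using p that by auto
  have pH: "p = map int H"
    unfolding H_def using nn by (simp add: map_idI)
  have "distinct H"
    using p(2) pH by (simp add: distinct_map)
  have setH: "set H = {0..<v}"
  proof -
    have "int ` set H = int ` {0..<v}"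
      using p(3) pH v by (auto simp: image_int_atLeastLessThan)
    then show ?thesis
      by (simp add: inj_image_eq_iff)
  qed
  have edges: "path_edges p = map (map_prod int int) (path_edges H)"
    unfolding path_edges_def pH map_tl[symmetric] zip_map_map map_prod_def by (rule refl)
  have L': "L = mset (map (\<lambda>(i, j). nat \<bar>int i - int j\<bar>) (path_edges H))"
    using p(4) unfolding diffs_def edges by (simp add: comp_def case_prod_unfold)
  have len: "0 < nat \<bar>int i - int j\<bar> \<and> nat \<bar>int i - int j\<bar> \<le> v div 2"
    if "(i, j) \<in> set (path_edges H)" for i j
    using that by (intro L) (force simp: L')
  have "path_lengths v H = L"
    unfolding path_lengths_def L' using len
    by (intro arg_cong[of _ _ mset] map_cong) (fastforce simp: edge_length_def)+
  moreover have "\<forall>(i, j) \<in> set (path_edges H). {i, j} \<in> complete_graph_edges v"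
  proof clarify
    fix i j
    assume ij: "(i, j) \<in> set (path_edges H)"
    then have "i \<in> set H" "j \<in> set H"
      unfolding path_edges_def by (auto dest: set_zip_leftD set_zip_rightD intro: list.set_sel(2))
    then show "{i, j} \<in> complete_graph_edges v"
      using len[OF ij] setH unfolding complete_graph_edges_def by fastforce
  qed
  ultimately show ?thesis
    using \<open>distinct H\<close> setH unfolding hamiltonian_path_def by blast
qed

section \<open>Walks with steps 1, \<open>w - 1\<close> and \<open>w\<close>\<close>

text \<open>The number of steps of length \<open>w\<close> is left open, since it can be recovered from \<open>card A\<close>.\<close>

definition wwalk :: "nat \<Rightarrow> int set \<Rightarrow> int \<Rightarrow> int \<Rightarrow> nat \<Rightarrow> nat \<Rightarrow> bool" where
  "wwalk w A s e a b \<longleftrightarrow>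
     (\<exists>c. walk A s e (replicate_mset a 1 + replicate_mset b (w - 1) + replicate_mset c w))"

lemma wwalk_single: "wwalk w {i} i i 0 0"
  unfolding wwalk_def by (intro exI[of _ 0]) (simp add: walk_single)

lemma wwalk_rev: "wwalk w A s e a b \<Longrightarrow> wwalk w A e s a b"
  unfolding wwalk_def by (auto intro: walk_rev)

lemma replicate_mset_add: "replicate_mset (m + n) i = replicate_mset m i + replicate_mset n i"
  by (induction m) auto

text \<open>One joining rule for each step length in the grid: 1 here, \<open>w - 1\<close> and
  \<open>w\<close> below.\<close>

lemma wwalk_join_1:
  assumes "wwalk w A s e a b" "wwalk w B s' e' a' b'" "A \<inter> B = {}" "\<bar>e - s'\<bar> = 1"
  shows "wwalk w (A \<union> B) s e' (Suc (a + a')) (b + b')"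
proof -
  obtain c c' where
    "walk A s e (replicate_mset a 1 + replicate_mset b (w - 1) + replicate_mset c w)"
    "walk B s' e' (replicate_mset a' 1 + replicate_mset b' (w - 1) + replicate_mset c' w)"
    using assms unfolding wwalk_def by blast
  from walk_join[OF this assms(3)] show ?thesis
    unfolding wwalk_def using assms(4)
    by (intro exI[of _ "c + c'"]) (simp add: replicate_mset_add ac_simps)
qed

lemma wwalk_join_pred:
  assumes "wwalk w A s e a b" "wwalk w B s' e' a' b'" "A \<inter> B = {}"
    "\<bar>e - s'\<bar> = int w - 1"
  shows "wwalk w (A \<union> B) s e' (a + a') (Suc (b + b'))"
proof -
  obtain c c' where
    "walk A s e (replicate_mset a 1 + replicate_mset b (w - 1) + replicate_mset c w)"
    "walk B s' e' (replicate_mset a' 1 + replicate_mset b' (w - 1) + replicate_mset c' w)"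
    using assms unfolding wwalk_def by blast
  moreover have "nat \<bar>e - s'\<bar> = w - 1"
    using assms(4) by simp
  ultimately show ?thesis
    using walk_join[of A s e _ B s' e', OF _ _ assms(3)] unfolding wwalk_def
    by (intro exI[of _ "c + c'"]) (fastforce simp add: replicate_mset_add ac_simps)
qed

lemma wwalk_join_width:
  assumes "wwalk w A s e a b" "wwalk w B s' e' a' b'" "A \<inter> B = {}" "\<bar>e - s'\<bar> = int w"
  shows "wwalk w (A \<union> B) s e' (a + a') (b + b')"
proof -
  obtain c c' where
    "walk A s e (replicate_mset a 1 + replicate_mset b (w - 1) + replicate_mset c w)"
    "walk B s' e' (replicate_mset a' 1 + replicate_mset b' (w - 1) + replicate_mset c' w)"
    using assms unfolding wwalk_def by blast
  from walk_join[OF this assms(3)] show ?thesis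
    unfolding wwalk_def using assms(4)
    by (intro exI[of _ "Suc (c + c')"]) (simp add: replicate_mset_add ac_simps)
qed

lemma standard_of_wwalk:
  assumes "wwalk w {0..<int v} 0 e a b" "v = a + b + c + 1"
  shows "standard (replicate_mset a 1 + replicate_mset b (w - 1) + replicate_mset c w)"
proof -
  obtain c' where
    *: "walk {0..<int v} 0 e (replicate_mset a 1 + replicate_mset b (w - 1) + replicate_mset c' w)"
    using assms unfolding wwalk_def by blast
  have "c' = c"
    using walk_card[OF *] assms(2) by simp
  moreover have "{0..<int v} = {0..int (a + b + c)}"
    using assms(2) by auto
  ultimately show ?thesis
    using * unfolding standard_def by auto
qed

section \<open>Columns and blocks of the grid\<close>

definition column :: "nat \<Rightarrow> int \<Rightarrow> int \<Rightarrow> int \<Rightarrow> int set" where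
  "column w j k l = (\<lambda>i. j + int w * i) ` {k..l}"

lemma column_disjoint:
  assumes "j \<noteq> j'" "\<bar>j - j'\<bar> < int w"
  shows "column w j k l \<inter> column w j' k' l' = {}"
proof -
  have False if "j + int w * i = j' + int w * i'" for i i'
  proof -
    have "j - j' = int w * (i' - i)"
      using that by (simp add: algebra_simps)
    then have "int w dvd j - j'"
      by simp
    then show False
      using assms dvd_imp_le_int[of "j - j'" "int w"] by simp
  qed
  then show ?thesis
    unfolding column_def by auto
qed

lemma mem_column:
  assumes "0 \<le> j" "j < int w"
  shows "n \<in> column w j k l \<longleftrightarrow> n mod int w = j \<and> k \<le> n div int w \<and> n div int w \<le> l"
proof -
  have "n = n mod int w + int w * (n div int w)"
    by simp
  then have "n \<in> column w (n mod int w) k l" if "k \<le> n div int w" "n div int w \<le> l"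
    unfolding column_def using that by (intro image_eqI) auto
  then show ?thesis
    using assms by (auto simp: column_def)
qed

lemma wwalk_column:
  assumes "k \<le> l" "0 < w"
  shows "wwalk w (column w j k l) (j + int w * k) (j + int w * l) 0 0"
  using assms(1)
proof (induction l rule: int_ge_induct)
  case base
  then show ?case by (simp add: column_def wwalk_single)
next
  case (step l)
  have "{k..l + 1} = insert (l + 1) {k..l}"
    using step.hyps by auto
  then have "column w j k (l + 1) = column w j k l \<union> {j + int w * (l + 1)}"
    by (simp add: column_def)
  moreover have "wwalk w (column w j k l \<union> {j + int w * (l + 1)}) (j + int w * k)
      (j + int w * (l + 1)) (0 + 0) (0 + 0)"
    using assms(2) by (intro wwalk_join_width[OF step.IH wwalk_single])
      (auto simp: column_def right_diff_distrib[symmetric] simp del: distrib_left_numeral)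
  ultimately show ?case by simp
qed

text \<open>Columns \<open>j < s\<close> reach row \<open>h + 1\<close>, the others row \<open>h\<close>; rows are counted from \<open>0\<close>.\<close>

definition height :: "int \<Rightarrow> int \<Rightarrow> int \<Rightarrow> int" where
  "height s h j = (if j < s then h + 1 else h)"

text \<open>\<open>n\<close> counts the changes of column, so the block has \<open>n + 1\<close>
  columns.\<close>

definition block :: "nat \<Rightarrow> int \<Rightarrow> int \<Rightarrow> int \<Rightarrow> nat \<Rightarrow> int set" where
  "block w s h p n = (\<Union>j\<in>{p..p + int n}. column w j 0 (height s h j))"

definition tip :: "nat \<Rightarrow> int \<Rightarrow> int \<Rightarrow> bool \<Rightarrow> int \<Rightarrow> int" where
  "tip w s h up j = j + int w * (if up then height s h j else 0)"

lemma wwalk_full_column: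
  assumes "0 \<le> h" "0 < w"
  shows "wwalk w (column w j 0 (height s h j)) (tip w s h up j) (tip w s h (\<not> up) j) 0 0"
proof -
  have "wwalk w (column w j 0 (height s h j)) (tip w s h False j) (tip w s h True j) 0 0"
    using wwalk_column[of 0 "height s h j" w j] assms by (simp add: tip_def height_def)
  then show ?thesis
    using wwalk_rev by (cases up) auto
qed

lemma column_block_disjoint:
  assumes "\<And>j'. j' \<in> {p..p + int n} \<Longrightarrow> j \<noteq> j' \<and> \<bar>j - j'\<bar> < int w"
  shows "block w s h p n \<inter> column w j k l = {}"
  unfolding block_def using column_disjoint[of _ j w] assms by fastforce

text \<open>The snake changes columns alternately at the lower and at the upper border; \<open>\<beta>\<close> tells
  whether it passes from column \<open>s - 1\<close> to column \<open>s\<close> at the upper one, by a step of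
  length \<open>w - 1\<close>.\<close>

lemma wwalk_snake:
  fixes p s :: int and up :: bool
  assumes "0 \<le> h" "n < w"
  defines "\<beta> \<equiv> \<lambda>n. (if p < s \<and> s \<le> p + int n \<and> (up = even (s - p)) then 1 else 0 :: nat)"
  shows "wwalk w (block w s h p n) (tip w s h up p) (tip w s h (up = odd n) (p + int n))
           (n - \<beta> n) (\<beta> n)"
  using assms(2)
proof (induction n)
  case 0
  then show ?case
    using wwalk_full_column[OF assms(1), of w p s up] by (auto simp: block_def \<beta>_def)
next
  case (Suc n)
  define j where "j = p + int n"
  have IH: "wwalk w (block w s h p n) (tip w s h up p) (tip w s h (up = odd n) j) (n - \<beta> n) (\<beta> n)"
    using Suc unfolding j_def by simp
  have col: "wwalk w (column w (j + 1) 0 (height s h (j + 1))) (tip w s h (up = odd n) (j + 1))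
      (tip w s h (up = odd (Suc n)) (j + 1)) 0 0"
    using wwalk_full_column[OF assms(1), of w "j + 1" s "up = odd n"] Suc.prems by auto
  have "{p..p + int (Suc n)} = insert (j + 1) {p..p + int n}"
    by (auto simp: j_def)
  then have block: "block w s h p (Suc n) = block w s h p n \<union> column w (j + 1) 0 (height s h (j + 1))"
    by (auto simp: block_def)
  have disj: "block w s h p n \<inter> column w (j + 1) 0 (height s h (j + 1)) = {}"
    using Suc.prems by (intro column_block_disjoint) (auto simp: j_def)
  have le: "\<beta> n \<le> n"
    by (auto simp: \<beta>_def)
  show ?case
  proof (cases "(up = odd n) \<and> s = j + 1")
    case True
    \<comment> \<open>Column \<open>j\<close> ends one row above column \<open>j + 1\<close>. Here
      \<open>s - p = n + 1\<close>, so the parity in \<open>\<beta>\<close> says that the change is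
      at the upper border.\<close>
    then have "\<bar>tip w s h (up = odd n) j - tip w s h (up = odd n) (j + 1)\<bar> = int w - 1"
      using Suc.prems by (simp add: tip_def height_def algebra_simps)
    from wwalk_join_pred[OF IH col disj this] show ?thesis
      using True block by (simp add: \<beta>_def j_def ac_simps)
  next
    case False
    then have "\<bar>tip w s h (up = odd n) j - tip w s h (up = odd n) (j + 1)\<bar> = 1"
      by (auto simp: tip_def height_def)
    moreover have "\<beta> (Suc n) = \<beta> n"
    proof (cases "s = j + 1")
      case True
      then show ?thesis
        using False by (simp add: \<beta>_def j_def)
    next
      case False
      then have "s \<le> p + int (Suc n) \<longleftrightarrow> s \<le> p + int n"
        by (auto simp: j_def)
      then show ?thesis
        by (simp only: \<beta>_def)
    qed
    ultimately show ?thesis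
      using wwalk_join_1[OF IH col disj] le by (simp add: block j_def Suc_diff_le ac_simps)
  qed
qed

text \<open>Rows 0 to \<open>h\<close> are complete, and row \<open>h + 1\<close> consists of its
  first \<open>s\<close> places.\<close>

lemma block_full:
  assumes "0 \<le> h" "0 \<le> s" "s < int w"
  shows "block w s h 0 (w - 1) = {0..<int w * (h + 1) + s}"
proof -
  have w: "0 < w" "int (w - 1) = int w - 1"
    using assms by auto
  have "n \<in> block w s h 0 (w - 1) \<longleftrightarrow> 0 \<le> n div int w \<and> n div int w \<le> height s h (n mod int w)" for n
    using w by (auto simp: block_def mem_column)
  moreover have "0 \<le> n div int w \<and> n div int w \<le> height s h (n mod int w) \<longleftrightarrow>
    n \<in> {0..<int w * (h + 1) + s}" for n
  proof -
    define d r where "d = n div int w" and "r = n mod int w"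
    have n: "n = int w * d + r" and r: "0 \<le> r" "r < int w"
      using w by (simp_all add: d_def r_def)
    have mono: "int w * i \<le> int w * k" if "i \<le> k" for i k
      using that by (simp add: mult_left_mono)
    \<comment> \<open>With the products named, only linear arithmetic remains.\<close>
    define D E where "D = int w * d" and "E = int w * h"
    have "d \<le> h \<Longrightarrow> D \<le> E" "h < d \<Longrightarrow> E + int w \<le> D" "d \<le> h + 1 \<Longrightarrow> D \<le> E + int w"
      "h + 1 < d \<Longrightarrow> E + 2 * int w \<le> D" "0 \<le> d \<Longrightarrow> 0 \<le> D" "d < 0 \<Longrightarrow> D \<le> - int w"
      using mono[of d "h + 1"] mono[of "h + 2" d] mono[of d h] mono[of "h + 1" d] mono[of 0 d]
        mono[of d "-1"] unfolding D_def E_def by (simp_all add: algebra_simps)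
    moreover have "n = D + r" "int w * (h + 1) = E + int w"
      using n by (simp_all add: D_def E_def algebra_simps)
    ultimately show ?thesis
      using r assms unfolding d_def[symmetric] r_def[symmetric] height_def atLeastLessThan_iff
      by (smt (verit))
  qed
  ultimately show ?thesis
    by blast
qed

lemma block_first_column:
  assumes "2 \<le> w"
  shows "block w s h 0 (w - 1) = column w 0 0 (height s h 0) \<union> block w s h 1 (w - 2)"
proof -
  have "{0..0 + int (w - 1)} = insert 0 {1..1 + int (w - 2)}"
    using assms by auto
  then show ?thesis
    by (simp add: block_def)
qed

text \<open>The snake climbs column 0 first, so it leaves column \<open>s - 1\<close> at the upper
  border exactly for odd \<open>s\<close>.\<close>

lemma wwalk_increasing:
  assumes "0 \<le> h" "0 \<le> s" "s < int w"
  shows "\<exists>e. wwalk w {0..<int w * (h + 1) + s} 0 e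
    (w - 1 - (if odd s then 1 else 0)) (if odd s then 1 else 0)"
proof -
  have *: "(0 < s \<and> s \<le> 0 + int (w - 1) \<and> (False = even (s - 0))) = odd s"
    using assms by (auto intro: le_neq_trans)
  show ?thesis
    using wwalk_snake[where p = 0 and n = "w - 1" and w = w and s = s and up = False,
        OF assms(1), unfolded *] assms
    unfolding block_full[OF assms(1-3)] by (auto simp: tip_def)
qed

text \<open>Column \<open>0\<close> upwards, then the columns \<open>w - 1\<close>, \<dots>, \<open>1\<close>.\<close>

lemma wwalk_wrapping:
  assumes "0 \<le> h" "0 \<le> s" "s < int w" "2 \<le> w" "even w \<or> h = 0 \<and> odd s"
  shows "\<exists>e. wwalk w {0..<int w * (h + 1) + s} 0 e
    (w - 1 - (if even s then 1 else 0)) (if even s then 1 else 0)"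
proof -
  define \<beta> :: nat where "\<beta> = (if 1 < s \<and> even s then 1 else 0)"
  have *: "(1 < s \<and> s \<le> 1 + int (w - 2) \<and> (False = even (s - 1))) = (1 < s \<and> even s)"
    using assms by auto
  have "1 + int (w - 2) = int w - 1" "odd (w - 2) \<longleftrightarrow> odd w"
    using assms(4) by auto
  then have "wwalk w (block w s h 1 (w - 2)) (tip w s h False 1)
      (tip w s h (even w) (int w - 1)) (w - 2 - \<beta>) \<beta>"
    using wwalk_snake[where p = 1 and n = "w - 2" and w = w and s = s and up = False,
        OF assms(1), unfolded *] assms(4) unfolding \<beta>_def by simp
  \<comment> \<open>For odd \<open>w\<close> the snake ends at the lower tip. As
    \<open>h = 0\<close> and column \<open>w - 1\<close> stops in row \<open>h\<close>, this is also
    the upper tip.\<close>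
  moreover have "tip w s h (even w) (int w - 1) = tip w s h True (int w - 1)"
    using assms by (auto simp: tip_def height_def)
  ultimately have B: "wwalk w (block w s h 1 (w - 2)) (tip w s h True (int w - 1))
      (tip w s h False 1) (w - 2 - \<beta>) \<beta>"
    by (simp add: wwalk_rev)
  have A: "wwalk w (column w 0 0 (height s h 0)) (tip w s h False 0) (tip w s h True 0) 0 0"
    using wwalk_full_column[of h w 0 s False] assms by simp
  have disj: "column w 0 0 (height s h 0) \<inter> block w s h 1 (w - 2) = {}"
    using column_block_disjoint[of 1 "w - 2" 0 w] assms by (simp add: Int_commute)
  have cover: "column w 0 0 (height s h 0) \<union> block w s h 1 (w - 2) = {0..<int w * (h + 1) + s}"
    using block_first_column[of w s h] block_full[of h s w] assms by simp
  show ?thesis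
  \<comment> \<open>If \<open>s = 0\<close>, both tips lie in row \<open>h\<close>, at distance
    \<open>w - 1\<close>; otherwise column 0 ends in row \<open>h + 1\<close>, just after the tip of
    column \<open>w - 1\<close>.\<close>
  proof (cases "s = 0")
    case True
    then have "\<bar>tip w s h True 0 - tip w s h True (int w - 1)\<bar> = int w - 1"
      using assms by (simp add: tip_def height_def algebra_simps)
    from wwalk_join_pred[OF A B disj this] show ?thesis
      using True cover by (auto simp: \<beta>_def tip_def numeral_2_eq_2)
  next
    case False
    then have "\<bar>tip w s h True 0 - tip w s h True (int w - 1)\<bar> = 1"
      using assms by (simp add: tip_def height_def algebra_simps)
    moreover have \<beta>: "(if even s then 1 else 0) = \<beta>" "Suc (0 + (w - 2 - \<beta>)) = w - 1 - \<beta>"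
    proof -
      have "1 < s" if "even s"
        using that False assms(2) by presburger
      then show "(if even s then 1 else 0) = \<beta>" "Suc (0 + (w - 2 - \<beta>)) = w - 1 - \<beta>"
        using assms by (auto simp: \<beta>_def)
    qed
    ultimately show ?thesis
      using wwalk_join_1[OF A B disj] unfolding cover \<beta> by (auto simp: tip_def)
  qed
qed

lemma column_split:
  assumes "k \<le> m + 1" "m \<le> l"
  shows "column w j k l = column w j k m \<union> column w j (m + 1) l"
proof -
  have "{k..l} = {k..m} \<union> {m + 1..l}"
    using assms by auto
  then show ?thesis
    by (simp add: column_def image_Un)
qed

lemma column_disjoint_rows:
  assumes "0 < w"
  shows "column w j k m \<inter> column w j (m + 1) l = {}"
  using assms by (auto simp: column_def)

text \<open>Vertex \<open>0\<close>, the columns \<open>w - 1\<close>, \<dots>, \<open>1\<close>, then the rest of column \<open>0\<close> downwards.\<close>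

lemma wwalk_two_pred_even:
  assumes "0 \<le> h" "0 \<le> s" "s < int w" "2 \<le> w" "even w" "odd s"
  shows "\<exists>e. wwalk w {0..<int w * (h + 1) + s} 0 e (w - 2) 2"
proof -
  define \<beta> :: nat where "\<beta> = (if 1 < s then 1 else 0)"
  have *: "(1 < s \<and> s \<le> 1 + int (w - 2) \<and> (True = even (s - 1))) = (1 < s)"
    using assms by auto
  have "1 + int (w - 2) = int w - 1" "even (w - 2)"
    using assms(4,5) by auto
  then have "wwalk w (block w s h 1 (w - 2)) (tip w s h True 1)
      (tip w s h False (int w - 1)) (w - 2 - \<beta>) \<beta>"
    using wwalk_snake[where p = 1 and n = "w - 2" and w = w and s = s and up = True,
        OF assms(1), unfolded *] assms(4) unfolding \<beta>_def by simp
  then have B: "wwalk w (block w s h 1 (w - 2)) (int w - 1) (tip w s h True 1) (w - 2 - \<beta>) \<beta>"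
    using wwalk_rev by (simp add: tip_def)
  have "height s h 0 = h + 1"
    using assms by (auto simp: height_def intro: le_neq_trans)
  then have cover: "{0} \<union> block w s h 1 (w - 2) \<union> column w 0 1 (h + 1) =
      {0..<int w * (h + 1) + s}"
    using block_first_column[of w s h] block_full[of h s w] column_split[of 0 0 "h + 1" w 0] assms
    by (auto simp: column_def)
  have C: "wwalk w (column w 0 1 (h + 1)) (int w * (h + 1)) (int w) 0 0"
    using wwalk_column[of 1 "h + 1" w 0] assms by (simp add: wwalk_rev)
  have "block w s h 1 (w - 2) \<inter> column w 0 0 0 = {}"
    and BC: "block w s h 1 (w - 2) \<inter> column w 0 1 (h + 1) = {}"
    using assms by (auto intro!: column_block_disjoint)
  then have "{0} \<inter> block w s h 1 (w - 2) = {}"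
    by (simp add: column_def)
  then have "wwalk w ({0} \<union> block w s h 1 (w - 2)) 0 (tip w s h True 1)
      (0 + (w - 2 - \<beta>)) (Suc (0 + \<beta>))"
    using assms by (intro wwalk_join_pred[OF wwalk_single B]) auto
  then have AB: "wwalk w ({0} \<union> block w s h 1 (w - 2)) 0 (tip w s h True 1)
      (w - 2 - \<beta>) (Suc \<beta>)"
    by simp
  have disj: "({0} \<union> block w s h 1 (w - 2)) \<inter> column w 0 1 (h + 1) = {}"
    using BC assms by (auto simp: column_def)
  show ?thesis
  \<comment> \<open>One step of length \<open>w - 1\<close> leaves 0. The second is the jump into
    column 0 if \<open>s = 1\<close>, and the change at \<open>s\<close> inside the snake
    otherwise.\<close>
  proof (cases "s = 1")
    case True
    then have "\<bar>tip w s h True 1 - int w * (h + 1)\<bar> = int w - 1"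
      using assms by (simp add: tip_def height_def algebra_simps)
    from wwalk_join_pred[OF AB C disj this] show ?thesis
      using True cover by (auto simp: \<beta>_def numeral_2_eq_2)
  next
    case False
    then have "1 < s"
      using assms(2,6) by presburger
    then have "\<bar>tip w s h True 1 - int w * (h + 1)\<bar> = 1" "\<beta> = 1"
      by (simp_all add: tip_def height_def \<beta>_def)
    moreover have "Suc (w - 2 - 1 + 0) = w - 2"
      using \<open>1 < s\<close> assms by auto
    ultimately show ?thesis
      using wwalk_join_1[OF AB C disj] unfolding cover by (auto simp: numeral_2_eq_2)
  qed
qed

text \<open>Vertices \<open>0\<close> and \<open>w\<close>, the columns \<open>1\<close>, \<dots>, \<open>w - 1\<close>, then the rest of column \<open>0\<close>
  downwards.\<close>

lemma wwalk_two_pred_odd: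
  assumes "1 \<le> h" "0 \<le> s" "s < int w" "2 \<le> w" "even w" "even s" "s = 0 \<longrightarrow> 2 \<le> h"
  shows "\<exists>e. wwalk w {0..<int w * (h + 1) + s} 0 e (w - 2) 2"
proof -
  define \<beta> :: nat where "\<beta> = (if 1 < s then 1 else 0)"
  \<comment> \<open>The top row of column 0; \<open>t\<close> is at least 2, so vertices above
    \<open>w\<close> remain for the final descent.\<close>
  define t where "t = height s h 0"
  have t: "2 \<le> t"
    using assms by (simp add: t_def height_def)
  have *: "(1 < s \<and> s \<le> 1 + int (w - 2) \<and> (False = even (s - 1))) = (1 < s)"
    using assms by auto
  have "1 + int (w - 2) = int w - 1" "even (w - 2)"
    using assms(4,5) by auto
  then have B: "wwalk w (block w s h 1 (w - 2)) 1 (tip w s h True (int w - 1)) (w - 2 - \<beta>) \<beta>"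
    using wwalk_snake[where p = 1 and n = "w - 2" and w = w and s = s and h = h and up = False,
        unfolded *] assms(1,4) unfolding \<beta>_def by (simp add: tip_def)
  have A: "wwalk w (column w 0 0 1) 0 (int w) 0 0"
    using wwalk_column[of 0 1 w 0] assms by simp
  have C: "wwalk w (column w 0 2 t) (int w * t) (2 * int w) 0 0"
    using wwalk_column[of 2 t w 0] assms t by (simp add: wwalk_rev mult.commute)
  have cover: "column w 0 0 1 \<union> block w s h 1 (w - 2) \<union> column w 0 2 t =
      {0..<int w * (h + 1) + s}"
    using block_first_column[of w s h] block_full[of h s w] column_split[of 0 1 t w 0] t assms
    by (auto simp: t_def)
  have AB: "column w 0 0 1 \<inter> block w s h 1 (w - 2) = {}"
    and BC: "block w s h 1 (w - 2) \<inter> column w 0 2 t = {}"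
    using column_block_disjoint[of 1 "w - 2" 0 w] assms by (auto simp: Int_commute)
  have disj: "(column w 0 0 1 \<union> block w s h 1 (w - 2)) \<inter> column w 0 2 t = {}"
    using column_disjoint_rows[of w 0 0 1 t] BC assms by auto
  have "wwalk w (column w 0 0 1 \<union> block w s h 1 (w - 2)) 0 (tip w s h True (int w - 1))
      (0 + (w - 2 - \<beta>)) (Suc (0 + \<beta>))"
    using assms by (intro wwalk_join_pred[OF A B AB]) auto
  then have AB: "wwalk w (column w 0 0 1 \<union> block w s h 1 (w - 2)) 0
      (tip w s h True (int w - 1)) (w - 2 - \<beta>) (Suc \<beta>)"
    by simp
  show ?thesis
  proof (cases "s = 0")
    case True
    then have "\<bar>tip w s h True (int w - 1) - int w * t\<bar> = int w - 1"
      using assms by (simp add: tip_def height_def t_def algebra_simps)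
    from wwalk_join_pred[OF AB C disj this] show ?thesis
      using True cover by (auto simp: \<beta>_def numeral_2_eq_2)
  next
    case False
    then have "1 < s"
      using assms(2,6) by presburger
    then have "\<bar>tip w s h True (int w - 1) - int w * t\<bar> = 1" "\<beta> = 1"
      using assms by (simp_all add: tip_def height_def t_def \<beta>_def algebra_simps)
    moreover have "Suc (w - 2 - 1 + 0) = w - 2"
      using \<open>1 < s\<close> assms by auto
    ultimately show ?thesis
      using wwalk_join_1[OF AB C disj] unfolding cover by (auto simp: numeral_2_eq_2)
  qed
qed

text \<open>Vertices \<open>0\<close>, \<open>1\<close>, \<open>w + 1\<close>, a snake from \<open>w\<close> down to \<open>4\<close>, then
  \<open>w + 3\<close>, \<open>3\<close>, \<open>w + 2\<close>, \<open>2\<close>.\<close>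

lemma wwalk_two_pred_short:
  assumes "4 \<le> s" "s \<le> int w" "even s"
  shows "\<exists>e. wwalk w {0..<int w + s} 0 e (w - 2) 2"
proof -
  have w: "4 \<le> w"
    using assms by simp
  have two: "column w j 0 1 = {j, j + int w}" for j
  proof -
    have "{0..1} = {0, 1::int}"
      by auto
    then show ?thesis
      by (simp add: column_def)
  qed
  have col: "column w j 0 (height s 0 j) = (if j < s then {j, j + int w} else {j})" for j
    using two by (simp add: height_def) (simp add: column_def)
  \<comment> \<open>Vertex \<open>w\<close> is treated as an additional column of height 0 that
    closes the snake.\<close>
  have block: "block w s 0 4 (w - 4) = {4..int w} \<union> {int w + 4..<int w + s}"
    (is "_ = ?B") unfolding block_def col
  proof (intro equalityI subsetI, goal_cases)
    case (1 n)
    then show ?case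
      using w by (auto split: if_splits)
  next
    case (2 n)
    then show ?case
    proof
      assume "n \<in> {4..int w}"
      then show ?thesis
        using w by (intro UN_I[of n]) auto
    next
      assume "n \<in> {int w + 4..<int w + s}"
      then show ?thesis
        using w assms by (intro UN_I[of "n - int w"]) auto
    qed
  qed
  \<comment> \<open>For even \<open>s\<close> the change at \<open>s\<close> takes place at the
    lower border and has length 1.\<close>
  have *: "(4 < s \<and> s \<le> 4 + int (w - 4) \<and> (False = even (s - 4))) = False"
    using assms by auto
  have "wwalk w (block w s 0 4 (w - 4)) 4 (int w) (w - 4) 0"
    using wwalk_snake[where p = 4 and n = "w - 4" and w = w and s = s and h = 0 and up = False,
        unfolded *] w assms by (simp add: tip_def height_def split: if_splits)
  then have B: "wwalk w ?B (int w) 4 (w - 4) 0"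
    unfolding block by (rule wwalk_rev)
  have up: "wwalk w {j, j + int w} j (j + int w) 0 0" for j
    using wwalk_column[of 0 1 w j] w by (simp add: two)
  have "wwalk w ({0} \<union> {1, 1 + int w}) 0 (1 + int w) (Suc (0 + 0)) (0 + 0)"
    using w by (intro wwalk_join_1[OF wwalk_single up]) auto
  then have "wwalk w ({0} \<union> {1, 1 + int w} \<union> ?B) 0 4 (Suc (Suc (0 + 0) + (w - 4))) (0 + 0 + 0)"
    by (intro wwalk_join_1[OF _ B]) auto
  then have "wwalk w ({0} \<union> {1, 1 + int w} \<union> ?B \<union> {3, 3 + int w}) 0 3
      (Suc (Suc (0 + 0) + (w - 4)) + 0) (Suc (0 + 0 + 0 + 0))"
    using w by (intro wwalk_join_pred[OF _ wwalk_rev[OF up]]) auto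
  then have "wwalk w ({0} \<union> {1, 1 + int w} \<union> ?B \<union> {3, 3 + int w} \<union> {2, 2 + int w}) 0 2
      (Suc (Suc (0 + 0) + (w - 4)) + 0 + 0) (Suc (Suc (0 + 0 + 0 + 0) + 0))"
    using w by (intro wwalk_join_pred[OF _ wwalk_rev[OF up]]) auto
  moreover have "{0} \<union> {1, 1 + int w} \<union> ?B \<union> {3, 3 + int w} \<union> {2, 2 + int w} = {0..<int w + s}"
    using assms by auto
  moreover have "Suc (Suc (0 + 0) + (w - 4)) + 0 + 0 = w - 2"
    using w by simp
  ultimately show ?thesis
    by (auto simp: numeral_2_eq_2)
qed

section \<open>Standard lists with zero, one or two steps of length \<open>w - 1\<close>\<close>

text \<open>With \<open>c = w * h + s\<close>, the increasing snake avoids length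
  \<open>w - 1\<close> for even \<open>s\<close>, the wrapping one for odd \<open>s\<close>.\<close>

lemma standard_pure:
  assumes "2 \<le> w" "even w \<or> even (c mod w) \<or> c < w"
  shows "standard (replicate_mset (w - 1) 1 + replicate_mset c w)"
proof -
  define h s where "h = int (c div w)" and "s = int (c mod w)"
  have hs: "0 \<le> h" "0 \<le> s" "s < int w"
    using assms(1) by (simp_all add: h_def s_def)
  have "int c = int w * h + s"
    unfolding h_def s_def by (metis mult_div_mod_eq of_nat_add of_nat_mult)
  then have v: "int w * (h + 1) + s = int (w + c)"
    by (simp add: algebra_simps)
  have "\<exists>e. wwalk w {0..<int (w + c)} 0 e (w - 1) 0"
  proof (cases "even s")
    case True
    then show ?thesis
      using wwalk_increasing[OF hs] by (simp add: v)
  next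
    case False
    then have "even w \<or> h = 0 \<and> odd s"
      using assms(2) by (auto simp: h_def s_def)
    then show ?thesis
      using wwalk_wrapping[OF hs assms(1)] False by (simp add: v)
  qed
  then obtain e where "wwalk w {0..<int (w + c)} 0 e (w - 1) 0"
    by blast
  from standard_of_wwalk[OF this, of c] show ?thesis
    using assms(1) by simp
qed

text \<open>The same two walks with the parities of \<open>s\<close> exchanged.\<close>

lemma standard_one_pred:
  assumes "2 \<le> w" "even w \<or> odd (c mod w)"
  shows "standard (replicate_mset (w - 2) 1 + replicate_mset 1 (w - 1) + replicate_mset c w)"
proof -
  define h s where "h = int (c div w)" and "s = int (c mod w)"
  have hs: "0 \<le> h" "0 \<le> s" "s < int w"
    using assms(1) by (simp_all add: h_def s_def)
  have "int c = int w * h + s"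
    unfolding h_def s_def by (metis mult_div_mod_eq of_nat_add of_nat_mult)
  then have v: "int w * (h + 1) + s = int (w + c)"
    by (simp add: algebra_simps)
  have *: "w - 1 - 1 = w - 2"
    by simp
  have "\<exists>e. wwalk w {0..<int (w + c)} 0 e (w - 2) 1"
  proof (cases "even s")
    case True
    then have "even w \<or> h = 0 \<and> odd s"
      using assms(2) by (auto simp: s_def)
    from wwalk_wrapping[OF hs assms(1) this] show ?thesis
      using True unfolding v if_P[OF True] * by blast
  next
    case False
    then show ?thesis
      using wwalk_increasing[OF hs] unfolding v if_P[OF False] * by blast
  qed
  then obtain e where "wwalk w {0..<int (w + c)} 0 e (w - 2) 1"
    by blast
  from standard_of_wwalk[OF this, of c] show ?thesis
    using assms(1) by simp
qed

text \<open>There are \<open>w + c + 1\<close> vertices, so the incomplete row is governed by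
  \<open>c + 1\<close>: even \<open>c\<close> gives odd \<open>s\<close>. Odd \<open>c\<close> below
  \<open>w\<close> takes the short construction.\<close>

lemma standard_two_pred:
  assumes "2 \<le> w" "even w" "even c \<or> 3 \<le> c"
  shows "standard (replicate_mset (w - 2) 1 + replicate_mset 2 (w - 1) + replicate_mset c w)"
proof -
  have div: "int k = int w * int (k div w) + int (k mod w)" for k
    by (metis mult_div_mod_eq of_nat_add of_nat_mult)
  consider "even c" | "odd c" "w \<le> c" | "odd c" "3 \<le> c" "c < w"
    using assms(3) by linarith
  then have "\<exists>e. wwalk w {0..<int (w + c + 1)} 0 e (w - 2) 2"
  proof cases
    case 1
    have "even (c mod w)"
      using 1 assms(2) by (simp add: dvd_mod_iff)
    moreover have "c mod w < w"
      using assms(1) by simp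
    ultimately have "c mod w + 1 < w"
      using assms(2) by (metis Suc_eq_plus1 Suc_lessI even_Suc)
    moreover have v: "int w * (int (c div w) + 1) + int (c mod w + 1) = int (w + c + 1)"
      using div[of c] by (simp add: algebra_simps)
    ultimately show ?thesis
      using wwalk_two_pred_even[of "int (c div w)" "int (c mod w + 1)" w, unfolded v] assms \<open>even (c mod w)\<close>
      by simp
  next
    case 2
    define h s where "h = (c + 1) div w" and "s = (c + 1) mod w"
    have c: "c + 1 = w * h + s"
      by (simp add: h_def s_def)
    have "w \<noteq> c"
      using 2 assms(2) by auto
    then have "w + 1 < c + 1"
      using 2 by simp
    have "s < w"
      using assms(1) by (simp add: s_def)
    have "h \<noteq> 0"
      using c \<open>s < w\<close> 2 by (intro notI) simp
    \<comment> \<open>Rules out \<open>c + 1 = w\<close>, where column 0 would have nothing above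
      vertex \<open>w\<close>.\<close>
    moreover have "h \<noteq> 1 \<or> s \<noteq> 0"
      using c \<open>w + 1 < c + 1\<close> by auto
    ultimately have "1 \<le> h" "s = 0 \<longrightarrow> 2 \<le> h"
      by auto
    moreover have "even s"
      using 2 assms(2) by (simp add: s_def dvd_mod_iff)
    moreover have "int w * (int h + 1) + int s = int (w + c + 1)"
    proof -
      have "int (c + 1) = int w * int h + int s"
        unfolding c by simp
      then show ?thesis
        by (simp add: algebra_simps)
    qed
    ultimately show ?thesis
      using wwalk_two_pred_odd[of "int h" "int s" w] assms \<open>s < w\<close> by simp
  next
    case 3
    then show ?thesis
      using wwalk_two_pred_short[of "int c + 1" w] by (simp add: add.assoc add.commute[of 1])
  qed
  then obtain e where "wwalk w {0..<int (w + c + 1)} 0 e (w - 2) 2"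
    by blast
  from standard_of_wwalk[OF this, of c] show ?thesis
    using assms(1) by simp
qed

section \<open>Choosing the two lists to be glued\<close>

lemma hamiltonian_path_of_standard:
  assumes "admissible v L" "standard M" "standard N" "L = replicate_mset k 1 + M + N"
  shows "\<exists>H. hamiltonian_path {0..<v} (complete_graph_edges v) H \<and> path_lengths v H = L"
proof -
  obtain s e where "walk {0..int (size L)} s e L"
    using standard_glue[OF standard_add_ones[OF assms(2)] assms(3), of k] assms(4) by metis
  then show ?thesis
    by (rule hamiltonian_path_of_walk[OF assms(1)])
qed

lemma standard_empty: "standard {#}"
  unfolding standard_def using walk_single[of 0] by auto

theorem theorem1p6:
  fixes x a b c v :: nat and L :: "nat multiset"
  assumes "x \<ge> 3"
    and "v = a + b + c + 1"
    and "L = replicate_mset a 1 + replicate_mset b x + replicate_mset c (x + 1)"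
    and "admissible v L"
    and "(odd x \<and> a \<ge> min (3 * x - 3) (b + 2 * x - 3)) \<or>
         (odd x \<and> a \<ge> 2 * x - 2 \<and> real c \<ge> 4 / 3 * real b) \<or>
         (even x \<and> a \<ge> min (3 * x - 1) (c + 2 * x - 1)) \<or>
         (even x \<and> a \<ge> 2 * x - 1 \<and> b \<ge> c)"
  shows "\<exists>H. hamiltonian_path {0..<v} (complete_graph_edges v) H \<and> path_lengths v H = L"
proof -
  let ?rep = "replicate_mset :: nat \<Rightarrow> nat \<Rightarrow> nat multiset"
  have real_b: "4 * b \<le> 3 * c" if "real c \<ge> 4 / 3 * real b"
    using that by linarith
  note realize = hamiltonian_path_of_standard[OF assms(4)]
  \<comment> \<open>The names \<open>pure\<close>, \<open>one\<close> and \<open>two\<close> count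
    the copies of \<open>x\<close> taken from the walk of width \<open>x + 1\<close>; the walk of
    width \<open>x\<close> supplies the others.\<close>
  have zero: ?thesis if "b = 0" "even (x + 1) \<or> even (c mod (x + 1)) \<or> c < x + 1" "x \<le> a"
    using that assms(1,3) standard_pure[of "x + 1" c]
    by (intro realize[of "?rep x 1 + ?rep c (x + 1)" "{#}" "a - x"] standard_empty)
      (auto intro!: multiset_eqI)
  have pure: ?thesis if "even x \<or> even (b mod x)" "even (x + 1) \<or> even (c mod (x + 1))"
    "2 * x - 1 \<le> a"
    using that assms(1,3) standard_pure[of x b] standard_pure[of "x + 1" c]
    by (intro realize[of "?rep (x - 1) 1 + ?rep b x" "?rep x 1 + ?rep c (x + 1)" "a - (2 * x - 1)"])
      (auto intro!: multiset_eqI)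
  have one: ?thesis if "1 \<le> b" "even x \<or> even ((b - 1) mod x)" "even (x + 1) \<or> odd (c mod (x + 1))"
    "2 * x - 2 \<le> a"
    using that assms(1,3) standard_pure[of x "b - 1"] standard_one_pred[of "x + 1" c]
    by (intro realize[of "?rep (x - 1) 1 + ?rep (b - 1) x"
          "?rep (x - 1) 1 + ?rep 1 x + ?rep c (x + 1)" "a - (2 * x - 2)"])
      (auto intro!: multiset_eqI)
  have two: ?thesis if "2 \<le> b" "even ((b - 2) mod x)" "odd x" "3 \<le> c" "2 * x - 2 \<le> a"
    using that assms(1,3) standard_pure[of x "b - 2"] standard_two_pred[of "x + 1" c]
    by (intro realize[of "?rep (x - 1) 1 + ?rep (b - 2) x"
          "?rep (x - 1) 1 + ?rep 2 x + ?rep c (x + 1)" "a - (2 * x - 2)"])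
      (auto intro!: multiset_eqI)
  \<comment> \<open>Both walks have width \<open>x + 1\<close>. Since \<open>x < x + 1\<close>, the
    one with \<open>x\<close> long steps exists for either parity, and removing these steps changes
    the parity of the residue of \<open>c\<close>.\<close>
  have double: ?thesis if "b = 0" "x + 1 \<le> c" "even x" "odd (c mod (x + 1))" "2 * x \<le> a"
  proof -
    have "(c - x) mod (x + 1) = (c + 1) mod (x + 1)"
      using that(2) by (metis Suc_eq_plus1 add.commute add_diff_inverse_nat add_leD1 add_Suc_right
          mod_add_self1 not_less plus_1_eq_Suc)
    \<comment> \<open>The residue of \<open>c\<close> is odd, hence not the even number
      \<open>x\<close>, and there is no wraparound.\<close>
    moreover have "(c + 1) mod (x + 1) = c mod (x + 1) + 1"
      using that(3,4) by (metis Suc_eq_plus1 mod_Suc nat.inject)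
    ultimately have "even ((c - x) mod (x + 1))"
      using that(4) by simp
    then show ?thesis
      using that assms(1,3) standard_pure[of "x + 1" "c - x"] standard_pure[of "x + 1" x]
      by (intro realize[of "?rep x 1 + ?rep (c - x) (x + 1)" "?rep x 1 + ?rep x (x + 1)" "a - 2 * x"])
        (auto intro!: multiset_eqI)
  qed
  show ?thesis
  proof (cases "even x")
    case True
    then have a: "2 * x - 1 \<le> a"
      using assms(1,5) by auto
    consider "even (c mod (x + 1))" | "odd (c mod (x + 1))" "1 \<le> b" | "odd (c mod (x + 1))" "b = 0"
      by linarith
    then show ?thesis
    proof cases
      case 3
      \<comment> \<open>An odd residue makes \<open>c\<close> positive; with \<open>b = 0\<close>
        this excludes \<open>b \<ge> c\<close>, and the remaining bound is at least
        \<open>2 * x\<close>.\<close>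
      then have "2 * x \<le> a"
        using assms(1,5) True by (cases "c = 0") auto
      then show ?thesis
        using 3 True zero double by (cases "c < x + 1") auto
    qed (use True a pure one in auto)
  next
    case False
    show ?thesis
    proof (cases "b = 0")
      case True
      then show ?thesis
        using False assms(1,5) by (intro zero) auto
    next
      case b: False
      then have a: "2 * x - 2 \<le> a"
        using False assms(1,5) by auto
      show ?thesis
      proof (cases "even ((b - 1) mod x)")
        case True
        then show ?thesis
          using False a b by (intro one) auto
      next
        case odd_pred: False
        have "b \<noteq> 1"
          using odd_pred by auto
        then have "2 \<le> b"
          using b by simp
        \<comment> \<open>The odd residue of \<open>b - 1\<close> is neither 0 nor the even
          \<open>x - 1\<close>, so both neighbours \<open>b - 2\<close> and \<open>b\<close> have
          even residues.\<close>
        have "(b - 1) mod x \<noteq> x - 1"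
          using odd_pred False by auto
        moreover have "b - 1 = Suc (b - 2)" "b = Suc (b - 1)"
          using \<open>2 \<le> b\<close> by auto
        ultimately have "b mod x = Suc ((b - 1) mod x)" "even ((b - 2) mod x)"
          using odd_pred mod_Suc[of "b - 1" x] mod_Suc[of "b - 2" x] by (auto split: if_splits)
        \<comment> \<open>For \<open>c \<ge> 3\<close> use \<open>two\<close>. Otherwise
          \<open>4 * b \<le> 3 * c\<close> fails because \<open>b \<ge> 2\<close>, and the first
          alternative gives \<open>2 * x - 1 \<le> a\<close>, as \<open>pure\<close>
          requires.\<close>
        then show ?thesis
          using two pure odd_pred False a \<open>2 \<le> b\<close> assms(1,5) real_b
          by (cases "3 \<le> c") auto
      qed
    qed
  qed
qed

end
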